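(* Let $G$ be a finite group acting on a finite nonempty set $X$, let $K$ be the classical Burnside kernel on $X$ and $Q$ the dual Burnside kernel on $G^*$. For all $g\in G^*$, $x\in X$, and integers $t\ge1$, $$d_Q(g,t)\le\max_{y\in X_g}d_K(y,t-1),\qquad d_K(x,t)\le\max_{h\in G_x}d_Q(h,t-1).$$
   Context: For $g\in G$ and $x\in X$ write $X_g:=\{x\in X: g\cdot x=x\}$, $G_x:=\{g\in G: g\cdot x=x\}$, and $G^*:=\{g\in G: X_g\neq\varnothing\}$. The classical Burnside kernel on $X$ is $$K(x,y)=\frac1{|G_x|}\sum_{g\in G_x\cap G_y}\frac1{|X_g|},$$ with stationary law $\pi_K(x)=|G_x|/(|G|\,|X/G|)$; the dual Burnside kernel on $G^*$ is $$Q(g,h)=\frac1{|X_g|}\sum_{x\in X_g\cap X_h}\frac1{|G_x|},$$ with stationary law $\pi_Q(g)=|X_g|/(|G|\,|X/G|)$. For a kernel $P$ on a finite set $S$ with stationary law $\pi$, $d_P(s,t):=\|P^t(s,\cdot)-\pi\|_{\mathrm{TV}}$, where $\|\mu-\nu\|_{\mathrm{TV}}=\frac12\sum_{s}|\mu(s)-\nu(s)|$. *)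

theory Defs
  imports Complex_Main "HOL-Algebra.Group_Action"
begin

text \<open>
  A kernel on a finite set S is a function P with entries P s u; only its values on
  S \<times> S are meaningful. The definitions below carry S explicitly.
\<close>

fun kernel_power :: "'s set \<Rightarrow> ('s \<Rightarrow> 's \<Rightarrow> real) \<Rightarrow> nat \<Rightarrow> 's \<Rightarrow> 's \<Rightarrow> real" where
  "kernel_power S P 0 s u = (if s = u then 1 else 0)"
| "kernel_power S P (Suc n) s u = (\<Sum>v\<in>S. P s v * kernel_power S P n v u)"

definition tv_norm :: "'s set \<Rightarrow> ('s \<Rightarrow> real) \<Rightarrow> ('s \<Rightarrow> real) \<Rightarrow> real" where
  "tv_norm S \<mu> \<nu> = 1 / 2 * (\<Sum>s\<in>S. \<bar>\<mu> s - \<nu> s\<bar>)"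

definition tv_to_stationary ::
  "'s set \<Rightarrow> ('s \<Rightarrow> 's \<Rightarrow> real) \<Rightarrow> ('s \<Rightarrow> real) \<Rightarrow> 's \<Rightarrow> nat \<Rightarrow> real" where
  "tv_to_stationary S P \<pi> s t = tv_norm S (kernel_power S P t s) \<pi>"

text \<open>
  An action of G on X is given as in \<^locale>\<open>group_action\<close>, by \<open>\<phi>\<close> with g acting as \<open>\<phi> g\<close>.
  The set of points of X fixed by g is \<^const>\<open>invariants\<close>, the subgroup fixing x is
  \<^const>\<open>stabilizer\<close>, and X/G is \<^const>\<open>orbits\<close>.
\<close>

definition gstar :: "('a, 'm) monoid_scheme \<Rightarrow> 'b set \<Rightarrow> ('a \<Rightarrow> 'b \<Rightarrow> 'b) \<Rightarrow> 'a set" where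
  "gstar G X \<phi> = {g \<in> carrier G. invariants X \<phi> g \<noteq> {}}"

definition burnside_kernel ::
  "('a, 'm) monoid_scheme \<Rightarrow> 'b set \<Rightarrow> ('a \<Rightarrow> 'b \<Rightarrow> 'b) \<Rightarrow> 'b \<Rightarrow> 'b \<Rightarrow> real" where
  "burnside_kernel G X \<phi> x y =
     1 / real (card (stabilizer G \<phi> x)) *
     (\<Sum>g \<in> stabilizer G \<phi> x \<inter> stabilizer G \<phi> y. 1 / real (card (invariants X \<phi> g)))"

definition burnside_law ::
  "('a, 'm) monoid_scheme \<Rightarrow> 'b set \<Rightarrow> ('a \<Rightarrow> 'b \<Rightarrow> 'b) \<Rightarrow> 'b \<Rightarrow> real" where
  "burnside_law G X \<phi> x =
     real (card (stabilizer G \<phi> x)) / (real (order G) * real (card (orbits G X \<phi>)))"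

definition dual_burnside_kernel ::
  "('a, 'm) monoid_scheme \<Rightarrow> 'b set \<Rightarrow> ('a \<Rightarrow> 'b \<Rightarrow> 'b) \<Rightarrow> 'a \<Rightarrow> 'a \<Rightarrow> real" where
  "dual_burnside_kernel G X \<phi> g h =
     1 / real (card (invariants X \<phi> g)) *
     (\<Sum>x \<in> invariants X \<phi> g \<inter> invariants X \<phi> h. 1 / real (card (stabilizer G \<phi> x)))"

definition dual_burnside_law ::
  "('a, 'm) monoid_scheme \<Rightarrow> 'b set \<Rightarrow> ('a \<Rightarrow> 'b \<Rightarrow> 'b) \<Rightarrow> 'a \<Rightarrow> real" where
  "dual_burnside_law G X \<phi> g =
     real (card (invariants X \<phi> g)) / (real (order G) * real (card (orbits G X \<phi>)))"

definition d_K ::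
  "('a, 'm) monoid_scheme \<Rightarrow> 'b set \<Rightarrow> ('a \<Rightarrow> 'b \<Rightarrow> 'b) \<Rightarrow> 'b \<Rightarrow> nat \<Rightarrow> real" where
  "d_K G X \<phi> = tv_to_stationary X (burnside_kernel G X \<phi>) (burnside_law G X \<phi>)"

definition d_Q ::
  "('a, 'm) monoid_scheme \<Rightarrow> 'b set \<Rightarrow> ('a \<Rightarrow> 'b \<Rightarrow> 'b) \<Rightarrow> 'a \<Rightarrow> nat \<Rightarrow> real" where
  "d_Q G X \<phi> =
     tv_to_stationary (gstar G X \<phi>) (dual_burnside_kernel G X \<phi>) (dual_burnside_law G X \<phi>)"

end

theory Submission
  imports Defs
begin

text \<open>
  Let A(g, x) be the uniform law on the fixed points of g and B(x, g) the uniform law on the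
  stabilizer of x. Then Q = AB and K = BA, and B maps the stationary law of K to that of Q,
  while A maps the law of Q to that of K. Hence Q^t = A K^(t-1) B: one starts K from a random
  point fixed by g and pushes the result forward by B, which does not increase total variation,
  so the average over the starting point is bounded by the maximum. The second inequality is
  the same argument with A and B exchanged.
\<close>

text \<open>In matrix form \<open>P\<close> = AB and \<open>R\<close> = BA, so B(AB)^n = (BA)^n B by
  associativity. The induction carries B past one factor \<open>P\<close> at a time.\<close>

lemma kernel_power_intertwine:
  assumes fin: "finite S" "finite T"
    and P: "\<And>s u. s \<in> S \<Longrightarrow> u \<in> S \<Longrightarrow> P s u = (\<Sum>y\<in>T. A s y * B y u)"
    and R: "\<And>x y. x \<in> T \<Longrightarrow> y \<in> T \<Longrightarrow> R x y = (\<Sum>s\<in>S. B x s * A s y)"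
    and h: "h \<in> S" and x: "x \<in> T"
  shows "(\<Sum>v\<in>S. B x v * kernel_power S P n v h) = (\<Sum>y\<in>T. kernel_power T R n x y * B y h)"
  using x
proof (induction n arbitrary: x)
  case 0
  have "(\<Sum>v\<in>S. B x v * kernel_power S P 0 v h) = (\<Sum>v\<in>S. if v = h then B x v else 0)"
    by (intro sum.cong) auto
  also have "\<dots> = B x h"
    using fin h by simp
  also have "\<dots> = (\<Sum>y\<in>T. if x = y then B y h else 0)"
    using fin 0 by simp
  also have "\<dots> = (\<Sum>y\<in>T. kernel_power T R 0 x y * B y h)"
    by (intro sum.cong) auto
  finally show ?case .
next
  case (Suc n)
  have "(\<Sum>v\<in>S. B x v * kernel_power S P (Suc n) v h)
      = (\<Sum>v\<in>S. \<Sum>u\<in>S. \<Sum>y\<in>T. B x v * A v y * (B y u * kernel_power S P n u h))"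
    using P by (simp add: sum_distrib_left sum_distrib_right mult.assoc cong: sum.cong)
  also have "\<dots> = (\<Sum>v\<in>S. \<Sum>y\<in>T. \<Sum>u\<in>S. B x v * A v y * (B y u * kernel_power S P n u h))"
    by (intro sum.cong refl sum.swap)
  also have "\<dots> = (\<Sum>y\<in>T. \<Sum>v\<in>S. \<Sum>u\<in>S. B x v * A v y * (B y u * kernel_power S P n u h))"
    by (rule sum.swap)
  \<comment> \<open>Summing over \<open>v\<close> first turns the adjacent factors B and A into
    \<open>R x y\<close>. What remains is the claim for \<open>n\<close> started at
    \<open>y\<close>, which is why \<open>x\<close> is generalised in the induction.\<close>
  also have "\<dots> = (\<Sum>y\<in>T. R x y * (\<Sum>u\<in>S. B y u * kernel_power S P n u h))"
    using R Suc.prems by (simp add: sum_product cong: sum.cong)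
  also have "\<dots> = (\<Sum>y\<in>T. \<Sum>z\<in>T. R x y * kernel_power T R n y z * B z h)"
    using Suc.IH by (simp add: sum_distrib_left mult.assoc cong: sum.cong)
  also have "\<dots> = (\<Sum>z\<in>T. \<Sum>y\<in>T. R x y * kernel_power T R n y z * B z h)"
    by (rule sum.swap)
  also have "\<dots> = (\<Sum>z\<in>T. kernel_power T R (Suc n) x z * B z h)"
    by (simp add: sum_distrib_right)
  finally show ?case .
qed

text \<open>(AB)^(n+1) = A(BA)^n B: splitting off the first A and the last B leaves one power fewer
  of the other kernel. This is where the shift from t to t - 1 comes from.\<close>

lemma kernel_power_Suc_factor:
  assumes fin: "finite S" "finite T"
    and P: "\<And>s u. s \<in> S \<Longrightarrow> u \<in> S \<Longrightarrow> P s u = (\<Sum>y\<in>T. A s y * B y u)"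
    and R: "\<And>x y. x \<in> T \<Longrightarrow> y \<in> T \<Longrightarrow> R x y = (\<Sum>s\<in>S. B x s * A s y)"
    and s: "s \<in> S" and h: "h \<in> S"
  shows "kernel_power S P (Suc n) s h
      = (\<Sum>x\<in>T. A s x * (\<Sum>y\<in>T. kernel_power T R n x y * B y h))"
proof -
  have "kernel_power S P (Suc n) s h
      = (\<Sum>v\<in>S. \<Sum>x\<in>T. A s x * (B x v * kernel_power S P n v h))"
    using P s by (simp add: sum_distrib_right mult.assoc cong: sum.cong)
  also have "\<dots> = (\<Sum>x\<in>T. \<Sum>v\<in>S. A s x * (B x v * kernel_power S P n v h))"
    by (rule sum.swap)
  also have "\<dots> = (\<Sum>x\<in>T. A s x * (\<Sum>y\<in>T. kernel_power T R n x y * B y h))"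
    using kernel_power_intertwine[OF fin P R h]
    by (simp add: sum_distrib_left[symmetric] cong: sum.cong)
  finally show ?thesis .
qed

text \<open>The triangle inequality moves the absolute value inside the sum over \<open>y\<close>;
  summing over \<open>u\<close> first then removes \<open>B\<close>, whose rows have mass 1.\<close>

lemma tv_norm_push_le:
  assumes nonneg: "\<And>y u. y \<in> T \<Longrightarrow> u \<in> S \<Longrightarrow> B y u \<ge> 0"
    and stoch: "\<And>y. y \<in> T \<Longrightarrow> (\<Sum>u\<in>S. B y u) = 1"
  shows "tv_norm S (\<lambda>u. \<Sum>y\<in>T. \<mu> y * B y u) (\<lambda>u. \<Sum>y\<in>T. \<nu> y * B y u) \<le> tv_norm T \<mu> \<nu>"
proof -
  have "(\<Sum>u\<in>S. \<bar>(\<Sum>y\<in>T. \<mu> y * B y u) - (\<Sum>y\<in>T. \<nu> y * B y u)\<bar>)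
      = (\<Sum>u\<in>S. \<bar>\<Sum>y\<in>T. (\<mu> y - \<nu> y) * B y u\<bar>)"
    by (simp add: sum_subtractf left_diff_distrib)
  also have "\<dots> \<le> (\<Sum>u\<in>S. \<Sum>y\<in>T. \<bar>(\<mu> y - \<nu> y) * B y u\<bar>)"
    by (intro sum_mono sum_abs)
  also have "\<dots> = (\<Sum>u\<in>S. \<Sum>y\<in>T. \<bar>\<mu> y - \<nu> y\<bar> * B y u)"
    using nonneg by (simp add: abs_mult cong: sum.cong)
  also have "\<dots> = (\<Sum>y\<in>T. \<Sum>u\<in>S. \<bar>\<mu> y - \<nu> y\<bar> * B y u)"
    by (rule sum.swap)
  also have "\<dots> = (\<Sum>y\<in>T. \<bar>\<mu> y - \<nu> y\<bar>)"
    using stoch by (simp add: sum_distrib_left[symmetric] cong: sum.cong)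
  finally show ?thesis
    by (simp add: tv_norm_def)
qed

text \<open>Convexity of the norm: as the weights have total mass 1, \<nu> is itself the mixture of
  copies of \<nu>, and the triangle inequality applies termwise.\<close>

lemma tv_norm_mixture_le:
  assumes nonneg: "\<And>x. x \<in> T \<Longrightarrow> a x \<ge> 0" and total: "(\<Sum>x\<in>T. a x) = 1"
  shows "tv_norm S (\<lambda>u. \<Sum>x\<in>T. a x * \<mu> x u) \<nu> \<le> (\<Sum>x\<in>T. a x * tv_norm S (\<mu> x) \<nu>)"
proof -
  have "(\<Sum>u\<in>S. \<bar>(\<Sum>x\<in>T. a x * \<mu> x u) - \<nu> u\<bar>)
      = (\<Sum>u\<in>S. \<bar>(\<Sum>x\<in>T. a x * \<mu> x u) - (\<Sum>x\<in>T. a x) * \<nu> u\<bar>)"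
    by (simp add: total)
  also have "\<dots> = (\<Sum>u\<in>S. \<bar>\<Sum>x\<in>T. a x * (\<mu> x u - \<nu> u)\<bar>)"
    by (simp add: sum_subtractf right_diff_distrib sum_distrib_right)
  also have "\<dots> \<le> (\<Sum>u\<in>S. \<Sum>x\<in>T. \<bar>a x * (\<mu> x u - \<nu> u)\<bar>)"
    by (intro sum_mono sum_abs)
  also have "\<dots> = (\<Sum>u\<in>S. \<Sum>x\<in>T. a x * \<bar>\<mu> x u - \<nu> u\<bar>)"
    using nonneg by (simp add: abs_mult cong: sum.cong)
  also have "\<dots> = (\<Sum>x\<in>T. a x * (\<Sum>u\<in>S. \<bar>\<mu> x u - \<nu> u\<bar>))"
    by (subst sum.swap) (simp add: sum_distrib_left)
  finally show ?thesis
    by (simp add: tv_norm_def sum_divide_distrib[symmetric])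
qed

text \<open>The extension by zero outside \<open>F\<close> lets sums over neighbours be written as
  sums over the whole space, so that kernels become matrix products.\<close>

definition uniform_law :: "'s set \<Rightarrow> 's \<Rightarrow> real" where
  "uniform_law F s = (if s \<in> F then 1 / real (card F) else 0)"

lemma uniform_law_nonneg: "uniform_law F s \<ge> 0"
  by (simp add: uniform_law_def)

lemma sum_uniform_law_mult:
  assumes "finite T" "F \<subseteq> T"
  shows "(\<Sum>x\<in>T. uniform_law F x * f x) = 1 / real (card F) * (\<Sum>x\<in>F. f x)"
proof -
  have "(\<Sum>x\<in>T. uniform_law F x * f x) = (\<Sum>x\<in>F. uniform_law F x * f x)"
    using assms by (intro sum.mono_neutral_right) (auto simp: uniform_law_def)
  then show ?thesis
    by (simp add: uniform_law_def sum_distrib_left cong: sum.cong)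
qed

lemma sum_uniform_law:
  assumes "finite T" "F \<subseteq> T" "F \<noteq> {}"
  shows "(\<Sum>x\<in>T. uniform_law F x) = 1"
  using sum_uniform_law_mult[OF assms(1,2), of "\<lambda>_. 1"] assms finite_subset[OF assms(2,1)] by simp

lemma sum_uniform_law_mult_le_Max:
  assumes "finite T" "F \<subseteq> T" "F \<noteq> {}"
  shows "(\<Sum>x\<in>T. uniform_law F x * f x) \<le> (MAX x\<in>F. f x)"
proof -
  have "finite F"
    using assms finite_subset by blast
  then have "(\<Sum>x\<in>F. f x) \<le> real (card F) * (MAX x\<in>F. f x)"
    by (intro sum_bounded_above) simp
  moreover have "card F > 0"
    using \<open>finite F\<close> assms by (simp add: card_gt_0_iff)
  ultimately show ?thesis
    unfolding sum_uniform_law_mult[OF assms(1,2)] by (simp add: field_simps)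
qed

text \<open>
  Both kernels arise from one incidence between \<open>S\<close> and \<open>T\<close> (for the Burnside processes:
  g fixes x), where \<open>F\<close> and \<open>E\<close> give the neighbours; the constant \<open>c\<close> normalises the
  degree-proportional laws.
\<close>

lemma tv_alternating_walk_le:
  fixes c :: real
  assumes fin: "finite S" "finite T"
    and F: "\<And>s. s \<in> S \<Longrightarrow> F s \<subseteq> T \<and> F s \<noteq> {}"
    and E: "\<And>y. y \<in> T \<Longrightarrow> E y \<subseteq> S \<and> E y \<noteq> {}"
    and inc: "\<And>s y. s \<in> S \<Longrightarrow> y \<in> T \<Longrightarrow> y \<in> F s \<longleftrightarrow> s \<in> E y"
    and P: "\<And>s u. s \<in> S \<Longrightarrow> u \<in> S \<Longrightarrow>
      P s u = 1 / real (card (F s)) * (\<Sum>y\<in>F s \<inter> F u. 1 / real (card (E y)))"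
    and R: "\<And>x y. x \<in> T \<Longrightarrow> y \<in> T \<Longrightarrow>
      R x y = 1 / real (card (E x)) * (\<Sum>s\<in>E x \<inter> E y. 1 / real (card (F s)))"
    and \<mu>: "\<And>s. s \<in> S \<Longrightarrow> \<mu> s = real (card (F s)) / c"
    and \<nu>: "\<And>y. y \<in> T \<Longrightarrow> \<nu> y = real (card (E y)) / c"
    and s: "s \<in> S"
  shows "tv_to_stationary S P \<mu> s (Suc n) \<le> (MAX y\<in>F s. tv_to_stationary T R \<nu> y n)"
proof -
  define A where "A s = uniform_law (F s)" for s
  define B where "B y = uniform_law (E y)" for y
  have finF: "finite (F s)" if "s \<in> S" for s
    using F[OF that] fin finite_subset by blast
  have finE: "finite (E y)" if "y \<in> T" for y
    using E[OF that] fin finite_subset by blast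
  \<comment> \<open>By the incidence symmetry \<open>inc\<close>, for \<open>y\<close> in
    \<open>F s\<close> the entry \<open>B y u\<close> is nonzero exactly when \<open>y\<close> also
    lies in \<open>F u\<close>; this produces the intersection in the formula for
    \<open>P\<close>.\<close>
  have P': "P s u = (\<Sum>y\<in>T. A s y * B y u)" if "s \<in> S" "u \<in> S" for s u
  proof -
    have "(\<Sum>y\<in>F s. B y u) = (\<Sum>y\<in>F s. if y \<in> F u then 1 / real (card (E y)) else 0)"
      using that F inc by (intro sum.cong) (auto simp: B_def uniform_law_def)
    then show ?thesis
      using that F fin finF
      by (simp add: A_def sum_uniform_law_mult P sum.inter_restrict)
  qed
  have R': "R x y = (\<Sum>s\<in>S. B x s * A s y)" if "x \<in> T" "y \<in> T" for x y
  proof -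
    have "(\<Sum>s\<in>E x. A s y) = (\<Sum>s\<in>E x. if s \<in> E y then 1 / real (card (F s)) else 0)"
      using that E inc by (intro sum.cong) (auto simp: A_def uniform_law_def)
    then show ?thesis
      using that E fin finE
      by (simp add: B_def sum_uniform_law_mult R sum.inter_restrict)
  qed
  \<comment> \<open>The degree \<open>card (E y)\<close> in \<nu> cancels against the uniform
    weight, so each neighbour of \<open>u\<close> contributes 1/c and the sum counts
    \<open>F u\<close>.\<close>
  have law: "(\<Sum>y\<in>T. \<nu> y * B y u) = \<mu> u" if "u \<in> S" for u
  proof -
    have "(\<Sum>y\<in>T. \<nu> y * B y u) = (\<Sum>y\<in>T. if y \<in> F u then 1 / c else 0)"
    proof (intro sum.cong refl)
      fix y assume y: "y \<in> T"
      then have "card (E y) \<noteq> 0"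
        using finE E by simp
      then show "\<nu> y * B y u = (if y \<in> F u then 1 / c else 0)"
        using y that inc by (simp add: \<nu> B_def uniform_law_def)
    qed
    also have "\<dots> = (\<Sum>y\<in>T \<inter> F u. 1 / c)"
      using fin by (simp only: sum.inter_restrict)
    also have "T \<inter> F u = F u"
      using F that by blast
    finally show ?thesis
      using that by (simp add: \<mu>)
  qed
  \<comment> \<open>\<open>D x\<close> is the law after \<open>n\<close> steps of \<open>R\<close>
    from \<open>x\<close> followed by one step of \<open>B\<close>.\<close>
  define D where "D x u = (\<Sum>y\<in>T. kernel_power T R n x y * B y u)" for x u
  have "tv_to_stationary S P \<mu> s (Suc n) = tv_norm S (\<lambda>u. \<Sum>x\<in>T. A s x * D x u) \<mu>"
    unfolding tv_to_stationary_def tv_norm_def D_def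
    using kernel_power_Suc_factor[OF fin P' R' s] by (simp del: kernel_power.simps cong: sum.cong)
  also have "\<dots> \<le> (\<Sum>x\<in>T. A s x * tv_norm S (D x) \<mu>)"
    using F s fin
    by (intro tv_norm_mixture_le) (auto simp: A_def uniform_law_nonneg sum_uniform_law)
  also have "\<dots> \<le> (\<Sum>x\<in>T. A s x * tv_to_stationary T R \<nu> x n)"
  proof (intro sum_mono mult_left_mono)
    fix x
    have "tv_norm S (D x) \<mu> = tv_norm S (D x) (\<lambda>u. \<Sum>y\<in>T. \<nu> y * B y u)"
      using law by (simp add: tv_norm_def cong: sum.cong)
    also have "\<dots> \<le> tv_to_stationary T R \<nu> x n"
      unfolding D_def tv_to_stationary_def
      using E fin
      by (intro tv_norm_push_le) (auto simp: B_def uniform_law_nonneg sum_uniform_law)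
    finally show "tv_norm S (D x) \<mu> \<le> tv_to_stationary T R \<nu> x n" .
  qed (simp add: A_def uniform_law_nonneg)
  also have "\<dots> \<le> (MAX y\<in>F s. tv_to_stationary T R \<nu> y n)"
    unfolding A_def using F s fin by (intro sum_uniform_law_mult_le_Max) auto
  finally show ?thesis .
qed

theorem theorem3p14:
  fixes G :: "('a, 'm) monoid_scheme" and X :: "'b set" and \<phi> :: "'a \<Rightarrow> 'b \<Rightarrow> 'b"
    and g :: 'a and x :: 'b and t :: nat
  assumes "group_action G X \<phi>"
    and "finite (carrier G)"
    and "finite X" and "X \<noteq> {}"
    and "g \<in> gstar G X \<phi>" and "x \<in> X" and "t \<ge> 1"
  shows "d_Q G X \<phi> g t \<le> (MAX y \<in> invariants X \<phi> g. d_K G X \<phi> y (t - 1)) \<and>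
         d_K G X \<phi> x t \<le> (MAX h \<in> stabilizer G \<phi> x. d_Q G X \<phi> h (t - 1))"
proof -
  interpret group_action G X \<phi>
    by fact
  have fin: "finite (gstar G X \<phi>)"
    using assms(2) by (simp add: gstar_def)
  have F: "invariants X \<phi> g \<subseteq> X \<and> invariants X \<phi> g \<noteq> {}" if "g \<in> gstar G X \<phi>" for g
    using that by (auto simp: gstar_def invariants_def)
  \<comment> \<open>The identity lies in every stabilizer, and an element of the stabilizer of
    \<open>x\<close> has \<open>x\<close> as a fixed point, hence belongs to
    \<open>gstar\<close>.\<close>
  have E: "stabilizer G \<phi> x \<subseteq> gstar G X \<phi> \<and> stabilizer G \<phi> x \<noteq> {}" if "x \<in> X" for x
    using that stabilizer_one_closed[OF that]
    by (auto simp: gstar_def invariants_def stabilizer_def)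
  have inc: "x \<in> invariants X \<phi> g \<longleftrightarrow> g \<in> stabilizer G \<phi> x"
    if "g \<in> gstar G X \<phi>" "x \<in> X" for g x
    using that by (auto simp: gstar_def invariants_def stabilizer_def)
  obtain n where t: "t = Suc n"
    using \<open>t \<ge> 1\<close> by (cases t) auto
  \<comment> \<open>The constant \<open>c\<close> is \<open>order G\<close> times the number of
    orbits, the common denominator of both stationary laws. This is what allows the two inequalities
    to be instances of one lemma with the two sides exchanged.\<close>
  have "d_Q G X \<phi> g t \<le> (MAX y \<in> invariants X \<phi> g. d_K G X \<phi> y (t - 1))"
    unfolding d_Q_def d_K_def t diff_Suc_1
    by (rule tv_alternating_walk_le[OF fin \<open>finite X\<close> F E inc dual_burnside_kernel_def
          burnside_kernel_def dual_burnside_law_def burnside_law_def \<open>g \<in> gstar G X \<phi>\<close>])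
  moreover have "d_K G X \<phi> x t \<le> (MAX h \<in> stabilizer G \<phi> x. d_Q G X \<phi> h (t - 1))"
    unfolding d_Q_def d_K_def t diff_Suc_1
    by (rule tv_alternating_walk_le[OF \<open>finite X\<close> fin E F inc[symmetric] burnside_kernel_def
          dual_burnside_kernel_def burnside_law_def dual_burnside_law_def \<open>x \<in> X\<close>])
  ultimately show ?thesis ..
qed

end
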